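(* There is a unique map $\Theta:\overline{\mathcal A}\times\mathrm{Grapho}(M)\to\overline{\mathcal A}$ such that $$h_{\Theta(\overline A,\varphi)}([\gamma])=h_{\overline A}([\varphi^{-1}\circ\gamma])\qquad\text{for all }\gamma\in\mathcal P_{\mathrm{gen}},\ \overline A\in\overline{\mathcal A},\ \varphi\in\mathrm{Grapho}(M).$$ Moreover, for each graphomorphism $\varphi\in\mathrm{Grapho}(M)$, the map $\Theta_\varphi:=\Theta(\cdot,\varphi):\overline{\mathcal A}\to\overline{\mathcal A}$ is a homeomorphism and (for $\mathbf G$ compact) preserves the Ashtekar–Lewandowski measure $\mu_0$. The inverse of $\Theta_\varphi$ is $\Theta_{\varphi^{-1}}$.
   Context: Paths. Fix a manifold $M$, a connected Lie group $\mathbf G$, and $r$ a positive integer, $\infty$ or $\omega$. Fix also the choice whether all paths are required to be piecewise embedded or not. A path is a piecewise $C^r$ map $[0,1]\to M$ (piecewise embedded, if so chosen). A path is trivial iff its image is a single point. The inverse is $\gamma^{-1}(t):=\gamma(1-t)$. Paths $\gamma_1,\gamma_2$ are composable iff $\gamma_1(1)=\gamma_2(0)$; then $(\gamma_1\gamma_2)(t):=\gamma_1(2t)$ for $t\in[0,\frac12]$ and $\gamma_2(2t-1)$ for $t\in[\frac12,1]$. An edge is a path $e$ such that $e(t_1)=e(t_2)$ implies $|t_1-t_2|\in\{0,1\}$. Two paths $\gamma_1,\gamma_2$ coincide up to the parametrization iff $\gamma_1=\gamma_2\circ\phi$ for some orientation preserving piecewise $C^r$ diffeomorphism $\phi:[0,1]\to[0,1]$.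 A path is finite iff it equals, up to the parametrization, a finite product of edges and trivial paths; all paths are assumed finite. Two paths are equivalent iff there is a finite sequence of paths from one to the other in which any two subsequent paths coincide up to the parametrization or up to insertion or deletion of a retracing $\delta\delta^{-1}$ (e.g. $\gamma_1\gamma_2$ and $\gamma_1\delta\delta^{-1}\gamma_2$). $\mathcal P_{\mathrm{gen}}$ is the set of all paths, $\mathcal P$ the set of equivalence classes $[\gamma]$; $\mathcal P$ is a groupoid. Segments of a path are its restrictions to connected subintervals, affinely stretched to domain $[0,1]$. Graphical maps. A map $\varphi:M\to M$ is a graphical homomorphism iff $\varphi\circ\gamma\in\mathcal P_{\mathrm{gen}}$ for all $\gamma\in\mathcal P_{\mathrm{gen}}$ and $\gamma\mapsto\varphi\circ\gamma$ induces a groupoid homomorphism on $\mathcal P$. It is a graphomorphism iff it is bijective and both $\varphi$ and $\varphi^{-1}$ are graphical homomorphisms. $\mathrm{Grapho}(M)$ is the set of all graphomorphisms. Generalized connections. A hyph $\upsilon$ is a finite collection $(\gamma_1,\dots,\gamma_n)$ of edges each having a free point: $\gamma_i$ has a point such that, for at least one direction, none of the segments of $\gamma_i$ starting in that point in this direction is (up to the parametrization) a full segment of some $\gamma_j$ with $j<i$. The number of its edges is $\#\upsilon$. Hyphs are directed by the ordering generated by decomposition of paths and inclusion. $\mathcal P_\upsilon$ is the subgroupoid of $\mathcal P$ freely generated by the classes of edges in $\upsilon$, and $\overline{\mathcal A}_\upsilon:=\mathrm{Hom}(\mathcal P_\upsilon,\mathbf G)\cong\mathbf G^{\#\upsilon}$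 with the topology of $\mathbf G^{\#\upsilon}$. The space of generalized connections is $\overline{\mathcal A}:=\mathrm{Hom}(\mathcal P,\mathbf G)=\varprojlim_\upsilon\overline{\mathcal A}_\upsilon$ with the projective limit topology, and $\pi_\upsilon:\overline{\mathcal A}\to\mathbf G^{\#\upsilon}$ are the canonical (evaluation) maps. An element $\overline A\in\overline{\mathcal A}$ is also written $h_{\overline A}:\mathcal P\to\mathbf G$. For compact $\mathbf G$, the Ashtekar–Lewandowski measure $\mu_0$ is the unique regular Borel measure on $\overline{\mathcal A}$ such that $(\pi_\upsilon)_*\mu_0$ is the (normalized) Haar measure on $\mathbf G^{\#\upsilon}$ for every hyph $\upsilon$. *)

theory Defs
  imports "HOL-Analysis.Analysis" "HOL-Algebra.Product_Groups"
begin

section \<open>Differentiability classes\<close>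

datatype regularity = CFin nat | CInf | COmega

fun Ck_on :: "nat \<Rightarrow> 'a::euclidean_space set \<Rightarrow> ('a \<Rightarrow> 'b::euclidean_space) \<Rightarrow> bool" where
  "Ck_on 0 U f \<longleftrightarrow> continuous_on U f"
| "Ck_on (Suc k) U f \<longleftrightarrow> (\<forall>x\<in>U. f differentiable (at x)) \<and>
     (\<forall>v. Ck_on k U (\<lambda>x. frechet_derivative f (at x) v))"

text \<open>
  Multi-indices are the functions in \<open>Basis \<rightarrow>\<^sub>E UNIV\<close>, so the sum is a power series in
  the coordinates of \<open>y - x\<close>.
\<close>

definition real_analytic_on :: "'a::euclidean_space set \<Rightarrow> ('a \<Rightarrow> 'b::euclidean_space) \<Rightarrow> bool" where
  "real_analytic_on U f \<longleftrightarrow>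
     (\<forall>x\<in>U. \<exists>\<epsilon>>0. \<exists>c :: ('a \<Rightarrow> nat) \<Rightarrow> 'b. \<forall>y\<in>ball x \<epsilon>.
        ((\<lambda>\<alpha>. (\<Prod>b\<in>Basis. ((y - x) \<bullet> b) ^ \<alpha> b) *\<^sub>R c \<alpha>) has_sum f y) (Basis \<rightarrow>\<^sub>E UNIV))"

fun Cr_open :: "regularity \<Rightarrow> 'a::euclidean_space set \<Rightarrow> ('a \<Rightarrow> 'b::euclidean_space) \<Rightarrow> bool" where
  "Cr_open (CFin k) U f \<longleftrightarrow> Ck_on k U f"
| "Cr_open CInf U f \<longleftrightarrow> (\<forall>k. Ck_on k U f)"
| "Cr_open COmega U f \<longleftrightarrow> real_analytic_on U f"

text \<open>
  On an arbitrary set, a map is of class \<open>C\<^sup>r\<close> if it locally extends to a \<open>C\<^sup>r\<close> map on an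
  open set. This is used for compact intervals (where it includes the boundary points) and for
  relatively open subsets of a linear subspace.
\<close>

definition Cr_on :: "regularity \<Rightarrow> 'a::euclidean_space set \<Rightarrow> ('a \<Rightarrow> 'b::euclidean_space) \<Rightarrow> bool" where
  "Cr_on r S f \<longleftrightarrow>
     (\<forall>x\<in>S. \<exists>W g. open W \<and> x \<in> W \<and> Cr_open r W g \<and> (\<forall>y\<in>S \<inter> W. g y = f y))"


section \<open>Manifolds and Lie groups\<close>

type_synonym ('m, 'e) atlas = "('m set \<times> ('m \<Rightarrow> 'e)) set"

text \<open>
  The model space is a linear subspace \<open>V\<close> of a Euclidean space, because \<open>DIM('e)\<close> is never
  \<open>0\<close> while zero-dimensional manifolds (in particular the trivial Lie group) are to be included.
  Values of a chart \<open>x\<close> outside its domain \<open>U\<close> are irrelevant.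
\<close>

definition Cr_manifold ::
  "regularity \<Rightarrow> 'e::euclidean_space set \<Rightarrow>
     ('m::{t2_space,second_countable_topology}, 'e) atlas \<Rightarrow> bool" where
  "Cr_manifold r V A \<longleftrightarrow>
     subspace V \<and>
     (\<forall>(U, x)\<in>A. open U \<and> openin (top_of_set V) (x ` U) \<and> (\<exists>y. homeomorphism U (x ` U) x y)) \<and>
     (\<Union>(U, x)\<in>A. U) = UNIV \<and>
     (\<forall>(U, x)\<in>A. \<forall>(U', x')\<in>A. Cr_on r (x ` (U \<inter> U')) (x' \<circ> inv_into U x))"

definition product_atlas ::
  "('m, 'e) atlas \<Rightarrow> ('n, 'f) atlas \<Rightarrow> ('m \<times> 'n, 'e \<times> 'f) atlas" where
  "product_atlas A B = {(U \<times> W, map_prod x y) | U x W y. (U, x) \<in> A \<and> (W, y) \<in> B}"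

definition Cr_map ::
  "regularity \<Rightarrow> ('m::topological_space, 'e::euclidean_space) atlas \<Rightarrow>
     ('n::topological_space, 'f::euclidean_space) atlas \<Rightarrow> ('m \<Rightarrow> 'n) \<Rightarrow> bool" where
  "Cr_map r A B f \<longleftrightarrow> continuous_on UNIV f \<and>
     (\<forall>(U, x)\<in>A. \<forall>(W, y)\<in>B. Cr_on r (x ` (U \<inter> f -` W)) (y \<circ> f \<circ> inv_into U x))"

definition Lie_group ::
  "'f::euclidean_space set \<Rightarrow> ('g::{t2_space,second_countable_topology}, 'f) atlas \<Rightarrow>
     'g monoid \<Rightarrow> bool" where
  "Lie_group V A G \<longleftrightarrow>
     Cr_manifold CInf V A \<and> group G \<and> carrier G = UNIV \<and>
     Cr_map CInf (product_atlas A A) A (\<lambda>(a, b). a \<otimes>\<^bsub>G\<^esub> b) \<and>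
     Cr_map CInf A A (\<lambda>a. inv\<^bsub>G\<^esub> a)"


section \<open>Paths\<close>

text \<open>
  As in HOL-Analysis, maps from the unit interval are represented by functions on all reals whose
  values outside \<open>{0..1}\<close> are irrelevant: paths that agree on \<open>{0..1}\<close> coincide up to the
  (identical) parametrization. Product and inverse of paths are \<^const>\<open>joinpaths\<close> and
  \<^const>\<open>reversepath\<close>.
\<close>

definition piecewise :: "(real set \<Rightarrow> bool) \<Rightarrow> bool" where
  "piecewise P \<longleftrightarrow> (\<exists>n (t :: nat \<Rightarrow> real). t 0 = 0 \<and> t n = 1 \<and>
     (\<forall>i<n. t i < t (Suc i) \<and> P {t i..t (Suc i)}))"

definition Cr_curve_on ::
  "regularity \<Rightarrow> ('m::topological_space, 'e::euclidean_space) atlas \<Rightarrow> real set \<Rightarrow>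
     (real \<Rightarrow> 'm) \<Rightarrow> bool" where
  "Cr_curve_on r A I \<gamma> \<longleftrightarrow> continuous_on I \<gamma> \<and>
     (\<forall>(U, x)\<in>A. Cr_on r {t \<in> I. \<gamma> t \<in> U} (x \<circ> \<gamma>))"

text \<open>An embedding is an immersion that is a homeomorphism onto its image.\<close>

definition Cr_embedded_on ::
  "regularity \<Rightarrow> ('m::topological_space, 'e::euclidean_space) atlas \<Rightarrow> real set \<Rightarrow>
     (real \<Rightarrow> 'm) \<Rightarrow> bool" where
  "Cr_embedded_on r A I \<gamma> \<longleftrightarrow> Cr_curve_on r A I \<gamma> \<and>
     (\<exists>g. homeomorphism I (\<gamma> ` I) \<gamma> g) \<and>
     (\<forall>t\<in>I. \<forall>(U, x)\<in>A. \<gamma> t \<in> U \<longrightarrow>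
        (\<exists>v. v \<noteq> 0 \<and> ((x \<circ> \<gamma>) has_vector_derivative v) (at t within I)))"

text \<open>
  The flag \<open>emb\<close> fixes whether all paths have to be piecewise embedded. The predicate does not
  yet contain the finiteness required of all paths; see \<open>finite_paths\<close> below.
\<close>

definition Cr_path ::
  "regularity \<Rightarrow> bool \<Rightarrow> ('m::topological_space, 'e::euclidean_space) atlas \<Rightarrow>
     (real \<Rightarrow> 'm) \<Rightarrow> bool" where
  "Cr_path r emb A \<gamma> \<longleftrightarrow> piecewise (\<lambda>I. Cr_curve_on r A I \<gamma>) \<and>
     (emb \<longrightarrow> piecewise (\<lambda>I. Cr_embedded_on r A I \<gamma>))"

definition trivial_path :: "(real \<Rightarrow> 'm::topological_space) \<Rightarrow> bool" where
  "trivial_path \<gamma> \<longleftrightarrow> (\<exists>p. path_image \<gamma> = {p})"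

definition edge ::
  "regularity \<Rightarrow> bool \<Rightarrow> ('m::topological_space, 'e::euclidean_space) atlas \<Rightarrow>
     (real \<Rightarrow> 'm) \<Rightarrow> bool" where
  "edge r emb A e \<longleftrightarrow> Cr_path r emb A e \<and>
     (\<forall>t1\<in>{0..1}. \<forall>t2\<in>{0..1}. e t1 = e t2 \<longrightarrow> \<bar>t1 - t2\<bar> \<in> {0, 1})"

definition reparametrization :: "regularity \<Rightarrow> (real \<Rightarrow> real) \<Rightarrow> bool" where
  "reparametrization r \<phi> \<longleftrightarrow>
     bij_betw \<phi> {0..1} {0..1} \<and> strict_mono_on {0..1} \<phi> \<and>
     piecewise (\<lambda>I. Cr_on r I \<phi>) \<and> piecewise (\<lambda>I. Cr_on r I (inv_into {0..1} \<phi>))"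

definition coincide :: "regularity \<Rightarrow> (real \<Rightarrow> 'm) \<Rightarrow> (real \<Rightarrow> 'm) \<Rightarrow> bool" where
  "coincide r \<gamma> \<delta> \<longleftrightarrow> (\<exists>\<phi>. reparametrization r \<phi> \<and> (\<forall>t\<in>{0..1}. \<gamma> t = \<delta> (\<phi> t)))"

inductive finite_product ::
  "regularity \<Rightarrow> bool \<Rightarrow> ('m::topological_space, 'e::euclidean_space) atlas \<Rightarrow>
     (real \<Rightarrow> 'm) \<Rightarrow> bool"
  for r emb A where
  edge: "edge r emb A \<gamma> \<Longrightarrow> finite_product r emb A \<gamma>"
| trivial: "Cr_path r emb A \<gamma> \<Longrightarrow> trivial_path \<gamma> \<Longrightarrow> finite_product r emb A \<gamma>"
| prod: "finite_product r emb A \<gamma> \<Longrightarrow> finite_product r emb A \<delta> \<Longrightarrow>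
    pathfinish \<gamma> = pathstart \<delta> \<Longrightarrow> finite_product r emb A (\<gamma> +++ \<delta>)"

text \<open>The set written \<open>P\<^sub>g\<^sub>e\<^sub>n\<close> in the literature.\<close>

definition finite_paths ::
  "regularity \<Rightarrow> bool \<Rightarrow> ('m::topological_space, 'e::euclidean_space) atlas \<Rightarrow>
     (real \<Rightarrow> 'm) set" where
  "finite_paths r emb A =
     {\<gamma>. Cr_path r emb A \<gamma> \<and> (\<exists>\<delta>. finite_product r emb A \<delta> \<and> coincide r \<gamma> \<delta>)}"


section \<open>The groupoid of paths\<close>

text \<open>
  The bracketing of the products is immaterial because of \<open>reparam\<close>. The retracing may also be
  inserted at either end of a path; without constant paths (which are not piecewise embedded) these
  cases are not instances of \<open>middle\<close>.
\<close>

inductive elementary_step ::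
  "regularity \<Rightarrow> bool \<Rightarrow> ('m::topological_space, 'e::euclidean_space) atlas \<Rightarrow>
     (real \<Rightarrow> 'm) \<Rightarrow> (real \<Rightarrow> 'm) \<Rightarrow> bool"
  for r emb A where
  reparam: "\<lbrakk>\<gamma> \<in> finite_paths r emb A; \<delta> \<in> finite_paths r emb A; coincide r \<gamma> \<delta>\<rbrakk>
    \<Longrightarrow> elementary_step r emb A \<gamma> \<delta>"
| middle: "\<lbrakk>\<gamma>1 \<in> finite_paths r emb A; \<gamma>2 \<in> finite_paths r emb A; \<delta> \<in> finite_paths r emb A;
      pathfinish \<gamma>1 = pathstart \<gamma>2; pathfinish \<gamma>1 = pathstart \<delta>\<rbrakk>
    \<Longrightarrow> elementary_step r emb A (\<gamma>1 +++ \<gamma>2) (\<gamma>1 +++ ((\<delta> +++ reversepath \<delta>) +++ \<gamma>2))"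
| left: "\<lbrakk>\<gamma> \<in> finite_paths r emb A; \<delta> \<in> finite_paths r emb A; pathstart \<gamma> = pathstart \<delta>\<rbrakk>
    \<Longrightarrow> elementary_step r emb A \<gamma> ((\<delta> +++ reversepath \<delta>) +++ \<gamma>)"
| right: "\<lbrakk>\<gamma> \<in> finite_paths r emb A; \<delta> \<in> finite_paths r emb A; pathfinish \<gamma> = pathstart \<delta>\<rbrakk>
    \<Longrightarrow> elementary_step r emb A \<gamma> (\<gamma> +++ (\<delta> +++ reversepath \<delta>))"

definition path_equiv ::
  "regularity \<Rightarrow> bool \<Rightarrow> ('m::topological_space, 'e::euclidean_space) atlas \<Rightarrow>
     (real \<Rightarrow> 'm) \<Rightarrow> (real \<Rightarrow> 'm) \<Rightarrow> bool" where
  "path_equiv r emb A = equivclp (elementary_step r emb A)"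

definition path_class ::
  "regularity \<Rightarrow> bool \<Rightarrow> ('m::topological_space, 'e::euclidean_space) atlas \<Rightarrow>
     (real \<Rightarrow> 'm) \<Rightarrow> (real \<Rightarrow> 'm) set" where
  "path_class r emb A \<gamma> = {\<delta> \<in> finite_paths r emb A. path_equiv r emb A \<gamma> \<delta>}"

definition path_classes ::
  "regularity \<Rightarrow> bool \<Rightarrow> ('m::topological_space, 'e::euclidean_space) atlas \<Rightarrow>
     (real \<Rightarrow> 'm) set set" where
  "path_classes r emb A = path_class r emb A ` finite_paths r emb A"

definition composable :: "(real \<Rightarrow> 'm::topological_space) set \<Rightarrow> (real \<Rightarrow> 'm) set \<Rightarrow> bool" where
  "composable p q \<longleftrightarrow> (\<exists>\<gamma>\<in>p. \<exists>\<delta>\<in>q. pathfinish \<gamma> = pathstart \<delta>)"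

definition class_mult ::
  "regularity \<Rightarrow> bool \<Rightarrow> ('m::topological_space, 'e::euclidean_space) atlas \<Rightarrow>
     (real \<Rightarrow> 'm) set \<Rightarrow> (real \<Rightarrow> 'm) set \<Rightarrow> (real \<Rightarrow> 'm) set" where
  "class_mult r emb A p q =
     \<Union>{path_class r emb A (\<gamma> +++ \<delta>) | \<gamma> \<delta>. \<gamma> \<in> p \<and> \<delta> \<in> q \<and> pathfinish \<gamma> = pathstart \<delta>}"

text \<open>
  Preservation of units and inverses is automatic for multiplicative maps between groupoids.
\<close>

definition groupoid_endo ::
  "regularity \<Rightarrow> bool \<Rightarrow> ('m::topological_space, 'e::euclidean_space) atlas \<Rightarrow>
     ((real \<Rightarrow> 'm) set \<Rightarrow> (real \<Rightarrow> 'm) set) \<Rightarrow> bool" where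
  "groupoid_endo r emb A F \<longleftrightarrow> F \<in> path_classes r emb A \<rightarrow> path_classes r emb A \<and>
     (\<forall>p\<in>path_classes r emb A. \<forall>q\<in>path_classes r emb A. composable p q \<longrightarrow>
        composable (F p) (F q) \<and>
        F (class_mult r emb A p q) = class_mult r emb A (F p) (F q))"

definition graphical_hom ::
  "regularity \<Rightarrow> bool \<Rightarrow> ('m::topological_space, 'e::euclidean_space) atlas \<Rightarrow>
     ('m \<Rightarrow> 'm) \<Rightarrow> bool" where
  "graphical_hom r emb A \<phi> \<longleftrightarrow>
     (\<forall>\<gamma>\<in>finite_paths r emb A. \<phi> \<circ> \<gamma> \<in> finite_paths r emb A) \<and>
     (\<exists>F. groupoid_endo r emb A F \<and>
        (\<forall>\<gamma>\<in>finite_paths r emb A. F (path_class r emb A \<gamma>) = path_class r emb A (\<phi> \<circ> \<gamma>)))"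

definition Grapho ::
  "regularity \<Rightarrow> bool \<Rightarrow> ('m::topological_space, 'e::euclidean_space) atlas \<Rightarrow> ('m \<Rightarrow> 'm) set" where
  "Grapho r emb A =
     {\<phi>. bij \<phi> \<and> graphical_hom r emb A \<phi> \<and> graphical_hom r emb A (inv_into UNIV \<phi>)}"


section \<open>Generalized connections\<close>

text \<open>The homomorphisms from the groupoid of paths to \<open>G\<close>, as extensional functions.\<close>

definition gen_connections ::
  "regularity \<Rightarrow> bool \<Rightarrow> ('m::topological_space, 'e::euclidean_space) atlas \<Rightarrow> 'g monoid \<Rightarrow>
     ((real \<Rightarrow> 'm) set \<Rightarrow> 'g) set" where
  "gen_connections r emb A G =
     {h \<in> path_classes r emb A \<rightarrow>\<^sub>E carrier G.
        \<forall>p\<in>path_classes r emb A. \<forall>q\<in>path_classes r emb A. composable p q \<longrightarrow>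
          h (class_mult r emb A p q) = h p \<otimes>\<^bsub>G\<^esub> h q}"

text \<open>
  This is \<^const>\<open>subpath\<close>, which is restricted to normed spaces. For \<open>v < u\<close> it is the
  inverse of the segment between \<open>v\<close> and \<open>u\<close>.
\<close>

definition path_segment :: "real \<Rightarrow> real \<Rightarrow> (real \<Rightarrow> 'm) \<Rightarrow> real \<Rightarrow> 'm" where
  "path_segment u v \<gamma> = (\<lambda>t. \<gamma> ((v - u) * t + u))"

text \<open>
  The nontrivial segments of \<open>\<gamma>\<close> that start in \<open>\<gamma> t\<close> are \<open>path_segment t s \<gamma>\<close>, with \<open>s > t\<close> in the
  positive and \<open>s < t\<close> in the negative direction; a direction only counts at \<open>t\<close> if it contains
  segments at all. Segments of the other paths are compared irrespective of their orientation, i.e.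
  both \<open>u < v\<close> and \<open>u > v\<close> occur: otherwise an edge and its inverse would form a hyph, although
  they are not free generators.
\<close>

definition full_segment_of :: "regularity \<Rightarrow> (real \<Rightarrow> 'm) \<Rightarrow> (real \<Rightarrow> 'm) \<Rightarrow> bool" where
  "full_segment_of r \<sigma> \<delta> \<longleftrightarrow> (\<exists>u\<in>{0..1}. \<exists>v\<in>{0..1}. coincide r \<sigma> (path_segment u v \<delta>))"

definition has_free_point ::
  "regularity \<Rightarrow> (real \<Rightarrow> 'm) \<Rightarrow> (real \<Rightarrow> 'm) set \<Rightarrow> bool" where
  "has_free_point r \<gamma> \<Delta> \<longleftrightarrow> (\<exists>t\<in>{0..1}.
     (t < 1 \<and> (\<forall>s\<in>{t<..1}. \<forall>\<delta>\<in>\<Delta>. \<not> full_segment_of r (path_segment t s \<gamma>) \<delta>)) \<or>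
     (0 < t \<and> (\<forall>s\<in>{0..<t}. \<forall>\<delta>\<in>\<Delta>. \<not> full_segment_of r (path_segment t s \<gamma>) \<delta>)))"

definition hyph ::
  "regularity \<Rightarrow> bool \<Rightarrow> ('m::topological_space, 'e::euclidean_space) atlas \<Rightarrow>
     (real \<Rightarrow> 'm) list \<Rightarrow> bool" where
  "hyph r emb A \<upsilon> \<longleftrightarrow> (\<forall>\<gamma>\<in>set \<upsilon>. edge r emb A \<gamma>) \<and>
     (\<forall>i<length \<upsilon>. has_free_point r (\<upsilon> ! i) (set (take i \<upsilon>)))"

definition power_group :: "'g monoid \<Rightarrow> nat \<Rightarrow> (nat \<Rightarrow> 'g) monoid" where
  "power_group G n = product_group {..<n} (\<lambda>_. G)"

definition power_topology :: "nat \<Rightarrow> (nat \<Rightarrow> 'g::topological_space) topology" where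
  "power_topology n = product_topology (\<lambda>_. euclidean) {..<n}"

definition hyph_eval ::
  "regularity \<Rightarrow> bool \<Rightarrow> ('m::topological_space, 'e::euclidean_space) atlas \<Rightarrow>
     (real \<Rightarrow> 'm) list \<Rightarrow> ((real \<Rightarrow> 'm) set \<Rightarrow> 'g) \<Rightarrow> nat \<Rightarrow> 'g" where
  "hyph_eval r emb A \<upsilon> h = (\<lambda>i\<in>{..<length \<upsilon>}. h (path_class r emb A (\<upsilon> ! i)))"

text \<open>
  The projective limit topology is the one inherited from the product of the spaces
  \<open>G ^ length \<upsilon>\<close> over all hyphs \<open>\<upsilon>\<close>, via the family of all evaluation maps.
\<close>

definition connection_topology ::
  "regularity \<Rightarrow> bool \<Rightarrow> ('m::topological_space, 'e::euclidean_space) atlas \<Rightarrow>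
     'g::topological_space monoid \<Rightarrow> ((real \<Rightarrow> 'm) set \<Rightarrow> 'g) topology" where
  "connection_topology r emb A G =
     pullback_topology (gen_connections r emb A G)
       (\<lambda>h. \<lambda>\<upsilon>\<in>{\<upsilon>. hyph r emb A \<upsilon>}. hyph_eval r emb A \<upsilon> h)
       (product_topology (\<lambda>\<upsilon>. power_topology (length \<upsilon>)) {\<upsilon>. hyph r emb A \<upsilon>})"


section \<open>The Ashtekar--Lewandowski measure\<close>

definition borel_of :: "'a topology \<Rightarrow> 'a measure" where
  "borel_of T = sigma (topspace T) {U. openin T U}"

definition regular_borel_measure :: "'a topology \<Rightarrow> 'a measure \<Rightarrow> bool" where
  "regular_borel_measure T \<mu> \<longleftrightarrow>
     sets \<mu> = sets (borel_of T) \<and>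
     (\<forall>K. compactin T K \<longrightarrow> emeasure \<mu> K < \<infinity>) \<and>
     (\<forall>B\<in>sets \<mu>. emeasure \<mu> B = (INF U\<in>{U. openin T U \<and> B \<subseteq> U}. emeasure \<mu> U)) \<and>
     (\<forall>B\<in>sets \<mu>. emeasure \<mu> B = (SUP K\<in>{K. compactin T K \<and> K \<subseteq> B}. emeasure \<mu> K))"

text \<open>Only meaningful for compact groups, where it determines \<open>\<mu>\<close> uniquely.\<close>

definition normalized_Haar :: "'a monoid \<Rightarrow> 'a topology \<Rightarrow> 'a measure \<Rightarrow> bool" where
  "normalized_Haar H T \<mu> \<longleftrightarrow> regular_borel_measure T \<mu> \<and> emeasure \<mu> (space \<mu>) = 1 \<and>
     (\<forall>a\<in>carrier H. \<forall>B\<in>sets \<mu>. emeasure \<mu> ((\<lambda>b. a \<otimes>\<^bsub>H\<^esub> b) ` B) = emeasure \<mu> B)"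

definition Haar_marginals ::
  "regularity \<Rightarrow> bool \<Rightarrow> ('m::topological_space, 'e::euclidean_space) atlas \<Rightarrow>
     'g::topological_space monoid \<Rightarrow> ((real \<Rightarrow> 'm) set \<Rightarrow> 'g) measure \<Rightarrow> bool" where
  "Haar_marginals r emb A G \<mu> \<longleftrightarrow>
     (\<forall>\<upsilon>. hyph r emb A \<upsilon> \<longrightarrow>
        normalized_Haar (power_group G (length \<upsilon>)) (power_topology (length \<upsilon>))
          (distr \<mu> (borel_of (power_topology (length \<upsilon>))) (hyph_eval r emb A \<upsilon>)))"

text \<open>
  \<open>\<mu>\<close> is \<^emph>\<open>the unique\<close> regular Borel measure with normalized Haar marginals. The definite
  description is rendered as a predicate, since no existence and uniqueness theorem is available here
  to justify a constant.
\<close>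

definition Ashtekar_Lewandowski ::
  "regularity \<Rightarrow> bool \<Rightarrow> ('m::topological_space, 'e::euclidean_space) atlas \<Rightarrow>
     'g::topological_space monoid \<Rightarrow> ((real \<Rightarrow> 'm) set \<Rightarrow> 'g) measure \<Rightarrow> bool" where
  "Ashtekar_Lewandowski r emb A G \<mu> \<longleftrightarrow>
     regular_borel_measure (connection_topology r emb A G) \<mu> \<and> Haar_marginals r emb A G \<mu> \<and>
     (\<forall>\<nu>. regular_borel_measure (connection_topology r emb A G) \<nu> \<and> Haar_marginals r emb A G \<nu>
        \<longrightarrow> \<nu> = \<mu>)"

definition grapho_action ::
  "regularity \<Rightarrow> bool \<Rightarrow> ('m::topological_space, 'e::euclidean_space) atlas \<Rightarrow> 'g monoid \<Rightarrow>
     (((real \<Rightarrow> 'm) set \<Rightarrow> 'g) \<times> ('m \<Rightarrow> 'm) \<Rightarrow> (real \<Rightarrow> 'm) set \<Rightarrow> 'g) \<Rightarrow> bool" where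
  "grapho_action r emb A G \<Theta> \<longleftrightarrow>
     \<Theta> \<in> gen_connections r emb A G \<times> Grapho r emb A \<rightarrow>\<^sub>E gen_connections r emb A G \<and>
     (\<forall>\<gamma>\<in>finite_paths r emb A. \<forall>h\<in>gen_connections r emb A G. \<forall>\<phi>\<in>Grapho r emb A.
        \<Theta> (h, \<phi>) (path_class r emb A \<gamma>) = h (path_class r emb A (inv_into UNIV \<phi> \<circ> \<gamma>)))"

end

theory Submission
  imports Defs
begin

text \<open>
  A graphomorphism maps edges to edges, and by injectivity it preserves and reflects segments up to
  the parametrization; hence it permutes the hyphs. On connections the action is the pull-back along
  \<open>\<phi>\<^sup>-\<^sup>1\<close>, which turns the evaluation at a hyph \<open>\<upsilon>\<close> into the evaluation at the hyph
  \<open>\<phi>\<^sup>-\<^sup>1 \<circ> \<upsilon>\<close>. So it is continuous for the projective limit topology, and the push-forward of the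
  Ashtekar--Lewandowski measure is again a regular Borel measure with normalized Haar marginals,
  i.e. the same measure.
\<close>

section \<open>Paths and graphomorphisms\<close>

lemma Ck_on_const: "Ck_on k U (\<lambda>_. c)"
  by (induction k arbitrary: c) (auto simp: frechet_derivative_const)

lemma Ck_on_ident: "Ck_on k U (\<lambda>x. x)"
  by (cases k) (auto simp: frechet_derivative_ident Ck_on_const)

text \<open>The expansion of y about x is x + (y - x), so the power series has only two nonzero
  coefficients and reduces to a finite sum.\<close>

lemma real_analytic_on_ident: "real_analytic_on U (\<lambda>x::real. x)"
  unfolding real_analytic_on_def
proof (intro ballI exI conjI)
  fix x y :: real
  \<comment> \<open>\<open>Basis\<close> of the reals is {1}, so a multi-index is given by its value
    at 1; \<open>?a n\<close> is the one of degree n.\<close>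
  let ?a = "\<lambda>n. \<lambda>b\<in>(Basis::real set). n :: nat"
  let ?c = "\<lambda>\<alpha> :: real \<Rightarrow> nat. if \<alpha> 1 = 0 then x else if \<alpha> 1 = 1 then 1 else 0"
  let ?f = "\<lambda>\<alpha>. (\<Prod>b\<in>Basis. ((y - x) \<bullet> b) ^ \<alpha> b) *\<^sub>R ?c \<alpha>"
  have ne: "?a 0 \<noteq> ?a 1"
    by (auto simp: fun_eq_iff)
  have "(?f has_sum sum ?f {?a 0, ?a 1}) (Basis \<rightarrow>\<^sub>E UNIV)"
  proof (rule has_sum_finite_neutralI)
    show "?f \<alpha> = 0" if "\<alpha> \<in> (Basis \<rightarrow>\<^sub>E UNIV) - {?a 0, ?a 1}" for \<alpha>
    proof -
      have "\<alpha> = ?a n" if "\<alpha> 1 = n" for n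
        using \<open>\<alpha> \<in> _\<close> that by (auto simp: PiE_iff extensional_def)
      with that have "\<alpha> 1 \<noteq> 0" "\<alpha> 1 \<noteq> 1"
        by blast+
      then show ?thesis by simp
    qed
  qed auto
  also have "sum ?f {?a 0, ?a 1} = y"
    using ne by simp
  finally show "(?f has_sum y) (Basis \<rightarrow>\<^sub>E UNIV)" .
\<comment> \<open>The sum was found for arbitrary y, so the still schematic radius may be set to
  1.\<close>
qed (rule zero_less_one)

lemma Cr_on_ident: "Cr_on r S (\<lambda>x::real. x)"
proof -
  have "Cr_open r UNIV (\<lambda>x::real. x)"
    by (cases r) (auto simp: Ck_on_ident real_analytic_on_ident)
  then show ?thesis
    unfolding Cr_on_def by (metis UNIV_I open_UNIV)
qed

lemma Cr_on_cong: "(\<And>x. x \<in> S \<Longrightarrow> f x = g x) \<Longrightarrow> Cr_on r S f \<longleftrightarrow> Cr_on r S g"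
  unfolding Cr_on_def by simp

lemma piecewise_unit: "P {0..1} \<Longrightarrow> piecewise P"
  \<comment> \<open>One piece: the subdivision points are \<open>real 0\<close> and
    \<open>real 1\<close>.\<close>
  unfolding piecewise_def by (intro exI[of _ 1] exI[of _ real]) simp

lemma reparametrization_ident: "reparametrization r (\<lambda>t. t)"
proof -
  \<comment> \<open>Outside {0..1} the values of \<open>inv_into\<close> are unknown; it is the
    identity only on the interval, hence the congruence.\<close>
  have "Cr_on r {0..1} (inv_into {0..1::real} (\<lambda>t. t))"
    by (subst Cr_on_cong[where g = "\<lambda>t. t"]) (auto intro: inv_into_f_eq Cr_on_ident)
  then show ?thesis
    unfolding reparametrization_def
    by (auto simp: bij_betw_def strict_mono_on_def intro!: piecewise_unit Cr_on_ident)
qed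

section \<open>Paths, segments and hyphs under injective maps\<close>

lemma coincide_refl: "coincide r \<gamma> \<gamma>"
  unfolding coincide_def using reparametrization_ident by auto

text \<open>A reparametrization acts on the parameter alone, so \<psi> can be cancelled pointwise.
  The equivalence matters: a free point requires that segments do not coincide, which is transported
  by the reflecting direction.\<close>

lemma coincide_comp_inj: "inj \<psi> \<Longrightarrow> coincide r (\<psi> \<circ> \<gamma>) (\<psi> \<circ> \<delta>) \<longleftrightarrow> coincide r \<gamma> \<delta>"
  unfolding coincide_def by (simp add: inj_eq)

lemma edge_in_finite_paths: "edge r emb A \<gamma> \<Longrightarrow> \<gamma> \<in> finite_paths r emb A"
  unfolding finite_paths_def using coincide_refl finite_product.edge
  by (fastforce simp: edge_def)

lemma graphical_hom_comp:
  "graphical_hom r emb A \<psi> \<Longrightarrow> \<gamma> \<in> finite_paths r emb A \<Longrightarrow> \<psi> \<circ> \<gamma> \<in> finite_paths r emb A"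
  unfolding graphical_hom_def by simp

lemma graphical_homE:
  assumes "graphical_hom r emb A \<psi>"
  obtains F where "groupoid_endo r emb A F" "\<And>\<gamma>. \<gamma> \<in> finite_paths r emb A \<Longrightarrow>
    F (path_class r emb A \<gamma>) = path_class r emb A (\<psi> \<circ> \<gamma>)"
  using assms unfolding graphical_hom_def by (elim conjE exE) simp

text \<open>No smoothness of \<psi> is assumed: the image is a path because \<psi> maps finite
  paths, and so edges, to finite paths. Injectivity excludes new self-intersections.\<close>

lemma edge_comp:
  assumes "inj \<psi>" "graphical_hom r emb A \<psi>" "edge r emb A \<gamma>"
  shows "edge r emb A (\<psi> \<circ> \<gamma>)"
proof -
  have "\<psi> \<circ> \<gamma> \<in> finite_paths r emb A"
    using assms by (simp add: edge_in_finite_paths graphical_hom_comp)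
  then show ?thesis
    using assms unfolding edge_def finite_paths_def by (auto dest: injD)
qed

lemma path_segment_comp: "path_segment u v (\<psi> \<circ> \<gamma>) = \<psi> \<circ> path_segment u v \<gamma>"
  by (simp add: path_segment_def fun_eq_iff)

lemma full_segment_of_comp_inj:
  "inj \<psi> \<Longrightarrow> full_segment_of r (\<psi> \<circ> \<sigma>) (\<psi> \<circ> \<delta>) \<longleftrightarrow> full_segment_of r \<sigma> \<delta>"
  unfolding full_segment_of_def by (simp add: path_segment_comp coincide_comp_inj)

lemma has_free_point_comp_inj:
  "inj \<psi> \<Longrightarrow> has_free_point r (\<psi> \<circ> \<gamma>) ((\<lambda>\<delta>. \<psi> \<circ> \<delta>) ` \<Delta>) \<longleftrightarrow> has_free_point r \<gamma> \<Delta>"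
  unfolding has_free_point_def by (simp add: path_segment_comp full_segment_of_comp_inj)

text \<open>An edge and its predecessors in the list are moved together, so each free point stays at
  the same parameter and in the same direction.\<close>

lemma hyph_comp:
  assumes "inj \<psi>" "graphical_hom r emb A \<psi>" "hyph r emb A \<upsilon>"
  shows "hyph r emb A (map (\<lambda>\<gamma>. \<psi> \<circ> \<gamma>) \<upsilon>)"
  using assms unfolding hyph_def
  by (auto simp: take_map has_free_point_comp_inj edge_comp)

lemma GraphoD:
  assumes "\<phi> \<in> Grapho r emb A"
  shows "bij \<phi>" "inj (inv_into UNIV \<phi>)" "graphical_hom r emb A \<phi>"
    "graphical_hom r emb A (inv_into UNIV \<phi>)"
  using assms by (auto simp: Grapho_def bij_imp_bij_inv bij_is_inj)

lemma inv_in_Grapho: "\<phi> \<in> Grapho r emb A \<Longrightarrow> inv_into UNIV \<phi> \<in> Grapho r emb A"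
  by (simp add: Grapho_def bij_imp_bij_inv inv_inv_eq)


section \<open>The action on generalized connections\<close>

text \<open>The induced map on classes is only asserted to exist in \<open>graphical_hom\<close>. A
  chosen representative turns it into an explicit term, which is meaningful on classes only.\<close>

definition class_map ::
  "regularity \<Rightarrow> bool \<Rightarrow> ('m::topological_space, 'e::euclidean_space) atlas \<Rightarrow>
     ('m \<Rightarrow> 'm) \<Rightarrow> (real \<Rightarrow> 'm) set \<Rightarrow> (real \<Rightarrow> 'm) set" where
  "class_map r emb A \<psi> p =
     path_class r emb A (\<psi> \<circ> (SOME \<gamma>. \<gamma> \<in> finite_paths r emb A \<and> path_class r emb A \<gamma> = p))"

text \<open>The choice of representative does not matter because the map F from
  \<open>graphical_hom\<close> depends on the class alone.\<close>

lemma class_map_path_class: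
  assumes "graphical_hom r emb A \<psi>" "\<gamma> \<in> finite_paths r emb A"
  shows "class_map r emb A \<psi> (path_class r emb A \<gamma>) = path_class r emb A (\<psi> \<circ> \<gamma>)"
proof -
  obtain F where F: "\<And>\<gamma>. \<gamma> \<in> finite_paths r emb A \<Longrightarrow>
      F (path_class r emb A \<gamma>) = path_class r emb A (\<psi> \<circ> \<gamma>)"
    using graphical_homE[OF assms(1)] by metis
  define \<delta> where
    "\<delta> = (SOME \<delta>. \<delta> \<in> finite_paths r emb A \<and> path_class r emb A \<delta> = path_class r emb A \<gamma>)"
  have "\<delta> \<in> finite_paths r emb A \<and> path_class r emb A \<delta> = path_class r emb A \<gamma>"
    unfolding \<delta>_def by (rule someI[where x = \<gamma>]) (use assms(2) in blast)
  then show ?thesis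
    unfolding class_map_def \<delta>_def[symmetric] using F assms(2) by metis
qed

lemma class_map_in_path_classes:
  assumes "graphical_hom r emb A \<psi>" "p \<in> path_classes r emb A"
  shows "class_map r emb A \<psi> p \<in> path_classes r emb A"
  using assms by (auto simp: path_classes_def class_map_path_class graphical_hom_comp)

text \<open>Both claims are inherited from F, which agrees with \<open>class_map\<close> on classes.
  Multiplicativity evaluates F at the product, hence the premise that the product is a
  class.\<close>

lemma class_map_composable:
  assumes "graphical_hom r emb A \<psi>" "p \<in> path_classes r emb A" "q \<in> path_classes r emb A"
    "composable p q"
  shows "composable (class_map r emb A \<psi> p) (class_map r emb A \<psi> q)"
    and "class_mult r emb A p q \<in> path_classes r emb A \<Longrightarrow>
      class_map r emb A \<psi> (class_mult r emb A p q) =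
      class_mult r emb A (class_map r emb A \<psi> p) (class_map r emb A \<psi> q)"
proof -
  obtain F where F: "groupoid_endo r emb A F" "\<And>\<gamma>. \<gamma> \<in> finite_paths r emb A \<Longrightarrow>
      F (path_class r emb A \<gamma>) = path_class r emb A (\<psi> \<circ> \<gamma>)"
    using graphical_homE[OF assms(1)] by metis
  have eq: "F p = class_map r emb A \<psi> p" if "p \<in> path_classes r emb A" for p
    using that F(2) class_map_path_class[OF assms(1)] unfolding path_classes_def by force
  show "composable (class_map r emb A \<psi> p) (class_map r emb A \<psi> q)"
    using F(1) assms(2-) unfolding groupoid_endo_def by (simp flip: eq)
  show "class_map r emb A \<psi> (class_mult r emb A p q) =
      class_mult r emb A (class_map r emb A \<psi> p) (class_map r emb A \<psi> q)"
    if "class_mult r emb A p q \<in> path_classes r emb A"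
    using F(1) assms(2-) that unfolding groupoid_endo_def by (simp flip: eq)
qed

lemma class_map_inverse:
  assumes "graphical_hom r emb A \<psi>" "graphical_hom r emb A \<psi>'" "\<And>x. \<psi>' (\<psi> x) = x"
    and "p \<in> path_classes r emb A"
  shows "class_map r emb A \<psi>' (class_map r emb A \<psi> p) = p"
proof -
  obtain \<gamma> where \<gamma>: "\<gamma> \<in> finite_paths r emb A" "p = path_class r emb A \<gamma>"
    using assms(4) unfolding path_classes_def by blast
  moreover have "\<psi> \<circ> \<gamma> \<in> finite_paths r emb A"
    using \<gamma>(1) assms(1) by (simp add: graphical_hom_comp)
  moreover have "\<psi>' \<circ> (\<psi> \<circ> \<gamma>) = \<gamma>"
    using assms(3) by (simp add: fun_eq_iff)
  ultimately show ?thesis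
    using class_map_path_class assms(1,2) by metis
qed

text \<open>For \<psi> = \<phi>^-1 this is the action of \<phi>. The restriction to classes keeps
  the result extensional, as connections are.\<close>

definition connection_pullback ::
  "regularity \<Rightarrow> bool \<Rightarrow> ('m::topological_space, 'e::euclidean_space) atlas \<Rightarrow>
     ('m \<Rightarrow> 'm) \<Rightarrow> ((real \<Rightarrow> 'm) set \<Rightarrow> 'g) \<Rightarrow> (real \<Rightarrow> 'm) set \<Rightarrow> 'g" where
  "connection_pullback r emb A \<psi> h = (\<lambda>p\<in>path_classes r emb A. h (class_map r emb A \<psi> p))"

lemma connection_pullback_path_class:
  assumes "graphical_hom r emb A \<psi>" "\<gamma> \<in> finite_paths r emb A"
  shows "connection_pullback r emb A \<psi> h (path_class r emb A \<gamma>) = h (path_class r emb A (\<psi> \<circ> \<gamma>))"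
  using assms by (simp add: connection_pullback_def class_map_path_class path_classes_def)

text \<open>
  Since \<open>\<psi>\<close> is invertible, a product of classes is a class if and only if its image is one. So it
  need not be known that \<^const>\<open>class_mult\<close> always yields classes: otherwise both
  connections take the value \<^const>\<open>undefined\<close>.
\<close>

lemma connection_pullback_in_gen_connections:
  assumes \<psi>: "graphical_hom r emb A \<psi>" "graphical_hom r emb A \<psi>'" "\<And>x. \<psi>' (\<psi> x) = x"
    and h: "h \<in> gen_connections r emb A G"
  shows "connection_pullback r emb A \<psi> h \<in> gen_connections r emb A G"
proof -
  let ?C = "path_classes r emb A" and ?m = "class_mult r emb A"
  let ?F = "class_map r emb A \<psi>" and ?F' = "class_map r emb A \<psi>'"
  let ?k = "connection_pullback r emb A \<psi> h"
  have h1: "h p \<in> carrier G" if "p \<in> ?C" for p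
    using h that unfolding gen_connections_def by blast
  have h2: "h p = undefined" if "p \<notin> ?C" for p
    using h that unfolding gen_connections_def by (auto simp: PiE_iff extensional_def)
  have h3: "h (?m p q) = h p \<otimes>\<^bsub>G\<^esub> h q" if "p \<in> ?C" "q \<in> ?C" "composable p q" for p q
    using h that unfolding gen_connections_def by blast
  have "?k (?m p q) = ?k p \<otimes>\<^bsub>G\<^esub> ?k q" if pq: "p \<in> ?C" "q \<in> ?C" "composable p q" for p q
  proof -
    have F: "?F p \<in> ?C" "?F q \<in> ?C" "composable (?F p) (?F q)"
      using class_map_in_path_classes class_map_composable(1) \<psi>(1) pq by blast+
    have "?k (?m p q) = h (?m (?F p) (?F q))"
    proof (cases "?m p q \<in> ?C")
      case True
      then show ?thesis
        using class_map_composable(2)[OF \<psi>(1) pq] by (simp add: connection_pullback_def)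
    next
      case False
      have "?m (?F p) (?F q) \<notin> ?C"
      proof
        assume C: "?m (?F p) (?F q) \<in> ?C"
        \<comment> \<open>By C the map \<open>?F'\<close> is multiplicative at \<open>?F p\<close>
          and \<open>?F q\<close>, and it undoes \<open>?F\<close> on p and q. So
          \<open>?m p q\<close> would be the image of a class.\<close>
        then have "?F' (?m (?F p) (?F q)) = ?m p q"
          using class_map_composable(2)[OF \<psi>(2) F] class_map_inverse[OF \<psi>] pq by simp
        then show False
          using False class_map_in_path_classes[OF \<psi>(2) C] by simp
      qed
      then show ?thesis
        using False h2 by (simp add: connection_pullback_def)
    qed
    then show ?thesis
      using h3[OF F] pq by (simp add: connection_pullback_def)
  qed
  moreover have "?k \<in> ?C \<rightarrow>\<^sub>E carrier G"
    using h1 class_map_in_path_classes[OF \<psi>(1)] by (simp add: connection_pullback_def)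
  ultimately show ?thesis
    unfolding gen_connections_def by blast
qed

text \<open>Pulling back reverses the order: at a class p the left side is h at the image of p under
  \<psi> followed by \<psi>'. Off the classes both sides are \<open>undefined\<close>.\<close>

lemma connection_pullback_inverse:
  assumes "graphical_hom r emb A \<psi>" "graphical_hom r emb A \<psi>'" "\<And>x. \<psi>' (\<psi> x) = x"
    and "h \<in> gen_connections r emb A G"
  shows "connection_pullback r emb A \<psi> (connection_pullback r emb A \<psi>' h) = h"
proof
  fix p
  show "connection_pullback r emb A \<psi> (connection_pullback r emb A \<psi>' h) p = h p"
    using assms(4) class_map_in_path_classes[OF assms(1)] class_map_inverse[OF assms(1-3)]
    by (cases "p \<in> path_classes r emb A")
       (auto simp: connection_pullback_def gen_connections_def PiE_iff extensional_def)
qed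

text \<open>The defining equation fixes \<Theta> (h, \<phi>) on every class, and extensionality of
  connections and of \<Theta> fixes the remaining values. Existence and uniqueness thus become one
  equation.\<close>

lemma grapho_action_iff:
  "grapho_action r emb A G \<Theta> \<longleftrightarrow>
     \<Theta> = (\<lambda>(h, \<phi>)\<in>gen_connections r emb A G \<times> Grapho r emb A.
       connection_pullback r emb A (inv_into UNIV \<phi>) h)"
    (is "_ \<longleftrightarrow> \<Theta> = ?\<Theta>")
proof
  let ?X = "gen_connections r emb A G \<times> Grapho r emb A"
  have mem: "connection_pullback r emb A (inv_into UNIV \<phi>) h \<in> gen_connections r emb A G"
    if "h \<in> gen_connections r emb A G" "\<phi> \<in> Grapho r emb A" for h \<phi>
    \<comment> \<open>The pullback is along \<phi>^-1, whose left inverse is \<phi> because \<phi>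
      is surjective.\<close>
    using that GraphoD[OF that(2)]
    by (intro connection_pullback_in_gen_connections[where \<psi>' = \<phi>])
       (auto simp: bij_is_surj surj_f_inv_f)
  show "grapho_action r emb A G \<Theta>" if "\<Theta> = ?\<Theta>"
    unfolding grapho_action_def that
    using mem by (auto simp: connection_pullback_path_class GraphoD)
  assume \<Theta>: "grapho_action r emb A G \<Theta>"
  show "\<Theta> = ?\<Theta>"
  proof (rule extensionalityI[of _ ?X])
    show "\<Theta> \<in> extensional ?X"
      using \<Theta> unfolding grapho_action_def by (simp add: PiE_iff)
    fix x assume "x \<in> ?X"
    then obtain h \<phi> where x: "x = (h, \<phi>)" "h \<in> gen_connections r emb A G" "\<phi> \<in> Grapho r emb A"
      by blast
    have "\<Theta> x \<in> gen_connections r emb A G"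
      using \<Theta> x unfolding grapho_action_def by blast
    then have ext: "\<Theta> x p = undefined" if "p \<notin> path_classes r emb A" for p
      using that unfolding gen_connections_def by (auto simp: PiE_iff extensional_def)
    have "\<Theta> x p = connection_pullback r emb A (inv_into UNIV \<phi>) h p" for p
    proof (cases "p \<in> path_classes r emb A")
      case True
      then show ?thesis
        using \<Theta> x unfolding grapho_action_def path_classes_def
        by (auto simp: connection_pullback_path_class GraphoD)
    qed (simp add: ext connection_pullback_def)
    then show "\<Theta> x = ?\<Theta> x"
      using x by auto
  qed simp
qed


section \<open>Topology\<close>

lemma hyph_eval_connection_pullback:
  assumes "graphical_hom r emb A \<psi>" "hyph r emb A \<upsilon>"
  shows "hyph_eval r emb A \<upsilon> (connection_pullback r emb A \<psi> h) =
    hyph_eval r emb A (map (\<lambda>\<gamma>. \<psi> \<circ> \<gamma>) \<upsilon>) h"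
  using assms
  by (auto simp: hyph_eval_def hyph_def fun_eq_iff connection_pullback_path_class
      edge_in_finite_paths)

lemma topspace_power_topology: "topspace (power_topology n) = {..<n} \<rightarrow>\<^sub>E UNIV"
  by (simp add: power_topology_def)

lemma hyph_eval_in_topspace: "hyph_eval r emb A \<upsilon> h \<in> topspace (power_topology (length \<upsilon>))"
  by (simp add: topspace_power_topology hyph_eval_def)

lemma topspace_connection_topology:
  "topspace (connection_topology r emb A G) = gen_connections r emb A G"
  by (auto simp: connection_topology_def topspace_pullback_topology hyph_eval_in_topspace)

lemma continuous_map_hyph_eval:
  assumes "hyph r emb A \<upsilon>"
  shows "continuous_map (connection_topology r emb A G) (power_topology (length \<upsilon>))
    (hyph_eval r emb A \<upsilon>)"
proof -
  let ?f = "\<lambda>h. \<lambda>\<upsilon>\<in>{\<upsilon>. hyph r emb A \<upsilon>}. hyph_eval r emb A \<upsilon> h"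
  \<comment> \<open>Evaluation at \<upsilon> is a coordinate of the joint evaluation map that
    defines the topology.\<close>
  have "continuous_map (connection_topology r emb A G) (power_topology (length \<upsilon>))
      ((\<lambda>x. x \<upsilon>) \<circ> ?f)"
    unfolding connection_topology_def
    by (intro continuous_map_pullback continuous_map_product_projection) (simp add: assms)
  then show ?thesis
    using assms by (simp add: o_def)
qed

text \<open>Universal property of the projective limit topology.\<close>

lemma continuous_map_connection_topologyI:
  assumes "f \<in> topspace X \<rightarrow> gen_connections r emb A G"
    and "\<And>\<upsilon>. hyph r emb A \<upsilon> \<Longrightarrow>
      continuous_map X (power_topology (length \<upsilon>)) (\<lambda>x. hyph_eval r emb A \<upsilon> (f x))"
  shows "continuous_map X (connection_topology r emb A G) f"
  unfolding connection_topology_def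
proof (rule continuous_map_pullback')
  show "topspace X \<subseteq> f -` gen_connections r emb A G"
    using assms(1) by blast
qed (auto simp: continuous_map_componentwise o_def assms(2))

lemma continuous_map_connection_pullback:
  assumes "inj \<psi>" "graphical_hom r emb A \<psi>" "graphical_hom r emb A \<psi>'" "\<And>x. \<psi>' (\<psi> x) = x"
  shows "continuous_map (connection_topology r emb A G) (connection_topology r emb A G)
    (connection_pullback r emb A \<psi>)"
proof (rule continuous_map_connection_topologyI)
  show "continuous_map (connection_topology r emb A G) (power_topology (length \<upsilon>))
      (\<lambda>h. hyph_eval r emb A \<upsilon> (connection_pullback r emb A \<psi> h))" if "hyph r emb A \<upsilon>" for \<upsilon>
    using continuous_map_hyph_eval[OF hyph_comp[OF assms(1,2) that]] assms that
    by (simp add: hyph_eval_connection_pullback)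
qed (auto simp: topspace_connection_topology
    intro: connection_pullback_in_gen_connections[OF assms(2-4)])


section \<open>Measure\<close>

lemma space_borel_of [simp]: "space (borel_of T) = topspace T"
  unfolding borel_of_def by (rule space_measure_of) (auto dest: openin_subset)

lemma sets_borel_of: "sets (borel_of T) = sigma_sets (topspace T) {U. openin T U}"
  unfolding borel_of_def by (rule sets_measure_of) (auto dest: openin_subset)

lemma openin_in_sets_borel_of: "openin T U \<Longrightarrow> U \<in> sets (borel_of T)"
  by (auto simp: sets_borel_of)

lemma continuous_map_measurable:
  assumes "continuous_map T T' f"
  shows "f \<in> measurable (borel_of T) (borel_of T')"
  unfolding borel_of_def[of T']
proof (rule measurable_measure_of)
  show "{U. openin T' U} \<subseteq> Pow (topspace T')"
    by (auto dest: openin_subset)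
  show "f \<in> space (borel_of T) \<rightarrow> topspace T'"
    using assms by (auto simp: continuous_map_def)
  fix U assume "U \<in> {U. openin T' U}"
  then have "openin T (f -` U \<inter> topspace T)"
    using assms by (simp add: continuous_map_alt)
  then show "f -` U \<inter> space (borel_of T) \<in> sets (borel_of T)"
    by (simp add: openin_in_sets_borel_of)
qed

lemma regular_borel_measure_distr:
  assumes f: "homeomorphic_maps T T' f g" and \<mu>: "regular_borel_measure T \<mu>"
  shows "regular_borel_measure T' (distr \<mu> (borel_of T') f)"
proof -
  let ?\<nu> = "distr \<mu> (borel_of T') f"
  have sets: "sets \<mu> = sets (borel_of T)"
    and fin: "\<And>K. compactin T K \<Longrightarrow> emeasure \<mu> K < \<infinity>"
    and outer: "\<And>B. B \<in> sets \<mu> \<Longrightarrow> emeasure \<mu> B = (INF U\<in>{U. openin T U \<and> B \<subseteq> U}. emeasure \<mu> U)"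
    and inner: "\<And>B. B \<in> sets \<mu> \<Longrightarrow> emeasure \<mu> B = (SUP K\<in>{K. compactin T K \<and> K \<subseteq> B}. emeasure \<mu> K)"
    using \<mu> unfolding regular_borel_measure_def by blast+
  have space: "space \<mu> = topspace T"
    using sets_eq_imp_space_eq[OF sets] by simp
  have cont: "continuous_map T T' f" "continuous_map T' T g"
    and gf: "\<And>x. x \<in> topspace T \<Longrightarrow> g (f x) = x" and fg: "\<And>y. y \<in> topspace T' \<Longrightarrow> f (g y) = y"
    using f unfolding homeomorphic_maps_def by auto
  have f_top: "f x \<in> topspace T'" if "x \<in> topspace T" for x
    using cont(1) that by (auto simp: continuous_map_def)
  have g_top: "g y \<in> topspace T" if "y \<in> topspace T'" for y
    using cont(2) that by (auto simp: continuous_map_def)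
  have f_meas: "f \<in> measurable \<mu> (borel_of T')"
    using continuous_map_measurable[OF cont(1)] measurable_cong_sets[OF sets refl] by blast
  have g_inj: "inj_on g (topspace T')"
    using fg by (rule inj_on_inverseI)
  have g_image: "g ` B = f -` B \<inter> topspace T" if "B \<subseteq> topspace T'" for B
    using that gf fg g_top f_top by (force simp: image_iff)
  have em: "emeasure ?\<nu> B = emeasure \<mu> (g ` B)" if B: "B \<subseteq> topspace T'" for B
  proof (cases "B \<in> sets (borel_of T')")
    case True
    then show ?thesis
      using emeasure_distr[OF f_meas True] g_image[OF B] space by simp
  next
    case False
    have "g ` B \<notin> sets \<mu>"
    proof
      assume "g ` B \<in> sets \<mu>"
      then have "g -` (g ` B) \<inter> topspace T' \<in> sets (borel_of T')"
        using measurable_sets[OF continuous_map_measurable[OF cont(2)]] sets by simp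
      also have "g -` (g ` B) \<inter> topspace T' = B"
        using B by (auto dest: inj_onD[OF g_inj])
      finally show False
        using False by blast
    qed
    with False show ?thesis
      by (simp add: emeasure_notin_sets)
  qed
  have g_sets: "g ` B \<in> sets \<mu>" if "B \<in> sets (borel_of T')" for B
    using measurable_sets[OF f_meas that] g_image[of B] sets.sets_into_space[OF that] space by simp
  have f_hom: "homeomorphic_map T T' f" and g_hom: "homeomorphic_map T' T g"
    using f by (simp_all add: homeomorphic_maps_map)
  have gf_image: "g ` f ` U = U" if "U \<subseteq> topspace T" for U
    using that gf by (force simp: image_iff)
  have g_subset: "g ` U \<subseteq> g ` U' \<longleftrightarrow> U \<subseteq> U'" if "U \<subseteq> topspace T'" "U' \<subseteq> topspace T'" for U U'
    using inj_on_image_subset_iff[OF g_inj that] .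
  \<comment> \<open>\<open>op\<close> and \<open>co\<close> are the reindexings along g used for
    outer and inner regularity.\<close>
  have op: "{U. openin T U \<and> g ` B \<subseteq> U} = (\<lambda>U. g ` U) ` {U. openin T' U \<and> B \<subseteq> U}"
    if B: "B \<subseteq> topspace T'" for B
  proof (intro equalityI subsetI)
    fix U assume U: "U \<in> {U. openin T U \<and> g ` B \<subseteq> U}"
    then have top: "U \<subseteq> topspace T" and op: "openin T' (f ` U)"
      using homeomorphic_map_openness[OF f_hom] by (auto dest: openin_subset)
    have "B \<subseteq> f ` U"
      using U g_subset[OF B openin_subset[OF op]] gf_image[OF top] by simp
    with op show "U \<in> (\<lambda>U. g ` U) ` {U. openin T' U \<and> B \<subseteq> U}"
      using gf_image[OF top] by (intro image_eqI[of _ _ "f ` U"]) auto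
  next
    fix U assume "U \<in> (\<lambda>U. g ` U) ` {U. openin T' U \<and> B \<subseteq> U}"
    then show "U \<in> {U. openin T U \<and> g ` B \<subseteq> U}"
      using homeomorphic_map_openness_eq[OF g_hom] by auto
  qed
  have co: "{K. compactin T K \<and> K \<subseteq> g ` B} = (\<lambda>K. g ` K) ` {K. compactin T' K \<and> K \<subseteq> B}"
    if B: "B \<subseteq> topspace T'" for B
  proof (intro equalityI subsetI)
    fix K assume K: "K \<in> {K. compactin T K \<and> K \<subseteq> g ` B}"
    then have top: "K \<subseteq> topspace T" and co: "compactin T' (f ` K)"
      using homeomorphic_map_compactness[OF f_hom] by (auto dest: compactin_subset_topspace)
    have "f ` K \<subseteq> B"
      using K g_subset[OF compactin_subset_topspace[OF co] B] gf_image[OF top] by simp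
    with co show "K \<in> (\<lambda>K. g ` K) ` {K. compactin T' K \<and> K \<subseteq> B}"
      using gf_image[OF top] by (intro image_eqI[of _ _ "f ` K"]) auto
  next
    fix K assume "K \<in> (\<lambda>K. g ` K) ` {K. compactin T' K \<and> K \<subseteq> B}"
    then show "K \<in> {K. compactin T K \<and> K \<subseteq> g ` B}"
      using homeomorphic_map_compactness_eq[OF g_hom] by auto
  qed
  show ?thesis
    unfolding regular_borel_measure_def
  proof (intro conjI allI impI ballI)
    fix K assume K: "compactin T' K"
    show "emeasure ?\<nu> K < \<infinity>"
      using K fin homeomorphic_map_compactness_eq[OF g_hom] em[OF compactin_subset_topspace[OF K]]
      by metis
  next
    fix B assume "B \<in> sets ?\<nu>"
    then have B: "B \<in> sets (borel_of T')" and top: "B \<subseteq> topspace T'"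
      using sets.sets_into_space by fastforce+
    have "emeasure ?\<nu> B = (INF U\<in>{U. openin T' U \<and> B \<subseteq> U}. emeasure \<mu> (g ` U))"
      unfolding em[OF top] outer[OF g_sets[OF B]] op[OF top] by (simp add: image_image)
    also have "\<dots> = (INF U\<in>{U. openin T' U \<and> B \<subseteq> U}. emeasure ?\<nu> U)"
      by (intro INF_cong refl) (simp add: em openin_subset)
    finally show "emeasure ?\<nu> B = (INF U\<in>{U. openin T' U \<and> B \<subseteq> U}. emeasure ?\<nu> U)" .
    have "emeasure ?\<nu> B = (SUP K\<in>{K. compactin T' K \<and> K \<subseteq> B}. emeasure \<mu> (g ` K))"
      unfolding em[OF top] inner[OF g_sets[OF B]] co[OF top] by (simp add: image_image)
    also have "\<dots> = (SUP K\<in>{K. compactin T' K \<and> K \<subseteq> B}. emeasure ?\<nu> K)"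
      by (intro SUP_cong refl) (simp add: em compactin_subset_topspace)
    finally show "emeasure ?\<nu> B = (SUP K\<in>{K. compactin T' K \<and> K \<subseteq> B}. emeasure ?\<nu> K)" .
  qed simp
qed

text \<open>The uniqueness clause is applied to the push-forward; the homeomorphism provides its
  regularity.\<close>

lemma Ashtekar_Lewandowski_connection_pullback:
  assumes \<psi>: "inj \<psi>" "graphical_hom r emb A \<psi>"
    and hom: "homeomorphic_maps (connection_topology r emb A G) (connection_topology r emb A G)
      (connection_pullback r emb A \<psi>) g"
    and \<mu>: "Ashtekar_Lewandowski r emb A G \<mu>"
  shows "distr \<mu> \<mu> (connection_pullback r emb A \<psi>) = \<mu>"
proof -
  let ?T = "connection_topology r emb A G" and ?f = "connection_pullback r emb A \<psi>"
  let ?\<nu> = "distr \<mu> (borel_of ?T) ?f"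
  have reg: "regular_borel_measure ?T \<mu>" and marg: "Haar_marginals r emb A G \<mu>"
    and uniq: "\<And>\<nu>. regular_borel_measure ?T \<nu> \<Longrightarrow> Haar_marginals r emb A G \<nu> \<Longrightarrow> \<nu> = \<mu>"
    using \<mu> unfolding Ashtekar_Lewandowski_def by blast+
  have sets: "sets \<mu> = sets (borel_of ?T)"
    using reg unfolding regular_borel_measure_def by blast
  have f_meas: "?f \<in> measurable \<mu> (borel_of ?T)"
    using hom continuous_map_measurable measurable_cong_sets[OF sets refl]
    unfolding homeomorphic_maps_def by blast
  have "Haar_marginals r emb A G ?\<nu>"
    unfolding Haar_marginals_def
  proof (intro allI impI)
    fix \<upsilon> assume \<upsilon>: "hyph r emb A \<upsilon>"
    let ?\<upsilon> = "map (\<lambda>\<gamma>. \<psi> \<circ> \<gamma>) \<upsilon>" and ?P = "borel_of (power_topology (length \<upsilon>))"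
    \<comment> \<open>The marginal of \<open>?\<nu>\<close> at \<upsilon> is the marginal of \<mu>
      at the image hyph, which has the same length and hence the same Haar measure.\<close>
    have "distr ?\<nu> ?P (hyph_eval r emb A \<upsilon>) = distr \<mu> ?P (hyph_eval r emb A \<upsilon> \<circ> ?f)"
      by (rule distr_distr[OF continuous_map_measurable[OF continuous_map_hyph_eval[OF \<upsilon>]] f_meas])
    also have "hyph_eval r emb A \<upsilon> \<circ> ?f = hyph_eval r emb A ?\<upsilon>"
      by (intro ext) (simp only: o_apply hyph_eval_connection_pullback[OF \<psi>(2) \<upsilon>])
    finally show "normalized_Haar (power_group G (length \<upsilon>)) (power_topology (length \<upsilon>))
        (distr ?\<nu> ?P (hyph_eval r emb A \<upsilon>))"
      using marg hyph_comp[OF \<psi> \<upsilon>] unfolding Haar_marginals_def by (metis length_map)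
  qed
  then have "?\<nu> = \<mu>"
    using uniq regular_borel_measure_distr[OF hom reg] by blast
  \<comment> \<open>The two push-forwards differ only in the target named, and the target
    contributes only its sigma-algebra.\<close>
  moreover have "distr \<mu> \<mu> ?f = ?\<nu>"
    by (rule distr_cong) (simp_all add: sets)
  ultimately show ?thesis by simp
qed

theorem corollary7p2:
  fixes r :: regularity and emb :: bool
    and V :: "'e::euclidean_space set"
    and A :: "('m::{t2_space,second_countable_topology}, 'e) atlas"
    and W :: "'f::euclidean_space set"
    and B :: "('g::{t2_space,second_countable_topology}, 'f) atlas"
    and G :: "'g monoid"
  assumes "r \<noteq> CFin 0"
    and "Cr_manifold r V A"
    and "Lie_group W B G" and "connected (UNIV :: 'g set)"
  shows "(\<exists>!\<Theta>. grapho_action r emb A G \<Theta>) \<and>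
    (\<forall>\<Theta>. grapho_action r emb A G \<Theta> \<longrightarrow> (\<forall>\<phi>\<in>Grapho r emb A.
       homeomorphic_map (connection_topology r emb A G) (connection_topology r emb A G)
         (\<lambda>h. \<Theta> (h, \<phi>)) \<and>
       (compact (UNIV :: 'g set) \<longrightarrow> (\<forall>\<mu>. Ashtekar_Lewandowski r emb A G \<mu> \<longrightarrow>
          (\<lambda>h. \<Theta> (h, \<phi>)) \<in> measurable \<mu> \<mu> \<and> distr \<mu> \<mu> (\<lambda>h. \<Theta> (h, \<phi>)) = \<mu>)) \<and>
       inv_into UNIV \<phi> \<in> Grapho r emb A \<and>
       (\<forall>h\<in>gen_connections r emb A G.
          \<Theta> (\<Theta> (h, \<phi>), inv_into UNIV \<phi>) = h \<and> \<Theta> (\<Theta> (h, inv_into UNIV \<phi>), \<phi>) = h)))"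
proof -
  let ?C = "gen_connections r emb A G" and ?T = "connection_topology r emb A G"
  have main: "homeomorphic_map ?T ?T (\<lambda>h. \<Theta> (h, \<phi>)) \<and>
      (\<forall>\<mu>. Ashtekar_Lewandowski r emb A G \<mu> \<longrightarrow>
        (\<lambda>h. \<Theta> (h, \<phi>)) \<in> measurable \<mu> \<mu> \<and> distr \<mu> \<mu> (\<lambda>h. \<Theta> (h, \<phi>)) = \<mu>) \<and>
      inv_into UNIV \<phi> \<in> Grapho r emb A \<and>
      (\<forall>h\<in>?C. \<Theta> (\<Theta> (h, \<phi>), inv_into UNIV \<phi>) = h \<and> \<Theta> (\<Theta> (h, inv_into UNIV \<phi>), \<phi>) = h)"
    if \<Theta>: "grapho_action r emb A G \<Theta>" and \<phi>: "\<phi> \<in> Grapho r emb A" for \<Theta> \<phi>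
  proof -
    let ?\<psi> = "inv_into UNIV \<phi>"
    let ?f = "connection_pullback r emb A ?\<psi>" and ?g = "connection_pullback r emb A \<phi>"
    note \<psi> = inv_in_Grapho[OF \<phi>]
    have inv: "?\<psi> (\<phi> x) = x" "\<phi> (?\<psi> x) = x" for x
      using GraphoD(1)[OF \<phi>] by (simp_all add: bij_is_inj bij_is_surj surj_f_inv_f)
    note hom = GraphoD(3,4)[OF \<phi>]
    \<comment> \<open>The element \<phi>^-1 acts by pullback along its own inverse, which is
      \<phi>.\<close>
    have f: "\<Theta> (h, \<phi>) = ?f h" "\<Theta> (h, ?\<psi>) = ?g h" if "h \<in> ?C" for h
      using \<Theta> that \<phi> \<psi> GraphoD(1)[OF \<phi>] by (simp_all add: grapho_action_iff inv_inv_eq)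
    have mem: "?f h \<in> ?C" "?g h \<in> ?C" if "h \<in> ?C" for h
      using connection_pullback_in_gen_connections[OF hom inv(1) that]
        connection_pullback_in_gen_connections[OF hom(2,1) inv(2) that] by blast+
    have fg: "?f (?g h) = h" "?g (?f h) = h" if "h \<in> ?C" for h
      using connection_pullback_inverse[OF hom inv(1) that]
        connection_pullback_inverse[OF hom(2,1) inv(2) that] by blast+
    have homeo: "homeomorphic_maps ?T ?T ?f ?g"
      unfolding homeomorphic_maps_def
      using continuous_map_connection_pullback[OF GraphoD(2)[OF \<phi>] hom(2,1) inv(2), where G = G]
        continuous_map_connection_pullback[OF bij_is_inj[OF GraphoD(1)[OF \<phi>]] hom inv(1), where G = G]
        fg
      by (simp add: topspace_connection_topology)
    \<comment> \<open>\<Theta> and \<open>?f\<close> are compared only on connections, that is, on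
      the underlying space of \<open>?T\<close>.\<close>
    have "homeomorphic_map ?T ?T (\<lambda>h. \<Theta> (h, \<phi>))"
      by (rule homeomorphic_map_eq[of ?T ?T ?f])
        (use homeo f in \<open>auto simp: homeomorphic_maps_map topspace_connection_topology\<close>)
    moreover have "(\<lambda>h. \<Theta> (h, \<phi>)) \<in> measurable \<mu> \<mu> \<and> distr \<mu> \<mu> (\<lambda>h. \<Theta> (h, \<phi>)) = \<mu>"
      if \<mu>: "Ashtekar_Lewandowski r emb A G \<mu>" for \<mu>
    proof -
      have sets: "sets \<mu> = sets (borel_of ?T)"
        using \<mu> unfolding Ashtekar_Lewandowski_def regular_borel_measure_def by blast
      then have eq: "?f h = \<Theta> (h, \<phi>)" if "h \<in> space \<mu>" for h
        using that f sets_eq_imp_space_eq[OF sets] by (simp add: topspace_connection_topology)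
      have "?f \<in> measurable \<mu> \<mu>"
        using homeo continuous_map_measurable measurable_cong_sets[OF sets sets]
        unfolding homeomorphic_maps_def by blast
      moreover have "distr \<mu> \<mu> ?f = \<mu>"
        using Ashtekar_Lewandowski_connection_pullback[OF GraphoD(2)[OF \<phi>] hom(2) homeo \<mu>] .
      ultimately show ?thesis
        using measurable_cong[of \<mu> ?f, OF eq]
          distr_cong[of \<mu> \<mu> \<mu> \<mu> ?f, OF refl refl eq] by simp
    qed
    moreover have "\<Theta> (\<Theta> (h, \<phi>), ?\<psi>) = h \<and> \<Theta> (\<Theta> (h, ?\<psi>), \<phi>) = h" if "h \<in> ?C" for h
      \<comment> \<open>\<open>mem\<close> certifies that the inner value is a connection, so that
        \<open>f\<close> also rewrites the outer application.\<close>
      by (simp only: f mem fg that simp_thms)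
    ultimately show ?thesis
      using \<psi> by blast
  qed
  have "\<exists>!\<Theta>. grapho_action r emb A G \<Theta>"
    unfolding grapho_action_iff by blast
  with main show ?thesis by blast
qed

end
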